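(* Let $K$ be a finite simplicial complex, let $F$ be an acyclic discrete vector field on $K$, and suppose the arrow $\alpha^{(p)}\to\beta^{(p+1)}$ is deleted from $F$ naturally, giving $\tilde F=F\setminus\{\alpha\to\beta\}$. Then no paths ending at $\alpha$ or starting at $\beta$ are deleted (i.e. every $F$-path that ends at $\alpha$ or starts at $\beta$ is an $\tilde F$-path). Additionally, for any $\tau^{(p+1)}\ne\beta$ and $\sigma^{(p)}\ne\alpha$ in $K$, the number of paths from $\tau$ to $\sigma$ decreases by $\Gamma(\tau,\alpha)\,\Gamma(\beta,\sigma)$, i.e. $$\Gamma_{\tilde F}(\tau,\sigma)=\Gamma_F(\tau,\sigma)-\Gamma_F(\tau,\alpha)\,\Gamma_F(\beta,\sigma).$$
   Context: Superscripts denote dimension; simplices are nonempty; $\alpha<\beta$ means $\alpha$ is a proper face of $\beta$. A discrete vector field $F$ on $K$ is a collection of pairs (arrows) $\{\alpha^{(p)}\to\beta^{(p+1)}\}$ with $\alpha<\beta$ and no simplex in more than one pair. An $F$-path starting at a $p$-simplex is a sequence $\alpha_0^{(p)},\beta_0^{(p+1)},\alpha_1^{(p)},\dots,\beta_r^{(p+1)},\alpha_{r+1}^{(p)}$ with $\{\alpha_i\to\beta_i\}\in F$, $\alpha_{i+1}<\beta_i$, and $\alpha_i\ne\alpha_{i+1}$ for each $i$; it is nontrivial if $r\ge0$ and closed if $\alpha_0=\alpha_{r+1}$. $F$ is acyclic if it has no nontrivial closed $F$-paths. In the assertion about paths starting at $\beta$ or ending at $\alpha$, the paths concerned are those of the following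 type, alternating between dimensions $p+1$ and $p$. An $F$-path starting at a $(p+1)$-simplex is a sequence $\tau=\beta_0>\alpha_1\to\beta_1>\alpha_2\to\dots\to\beta_r>\alpha_{r+1}=\sigma$ with $r\ge0$, where the $\beta_i$ are $(p+1)$-simplices, the $\alpha_i$ are $p$-simplices, $\alpha_{i+1}<\beta_i$ for $0\le i\le r$, $\{\alpha_i\to\beta_i\}\in F$ and $\alpha_{i}\ne\alpha_{i+1}$ for $1\le i\le r$, and $\beta_i\ne\beta_{i+1}$ for $0\le i<r$ (so a path may not start $\beta_0>\alpha_1\to\beta_0$). In particular a codimension-1 face relation $\tau>\sigma$ is itself a path ($r=0$), whether or not $\{\sigma\to\tau\}\in F$. $\Gamma_F(\tau,\sigma)$ is the number of $F$-paths from the $(p+1)$-simplex $\tau$ to the $p$-simplex $\sigma$. Adding an arrow $\alpha\to\beta$ to an acyclic discrete vector field $G$ occurs naturally if $G\sqcup\{\alpha\to\beta\}$ (disjoint union) is an acyclic discrete vector field. A deletion of $\alpha\to\beta$, changing $F$ to $\tilde F$, occurs naturally if $F$ can be obtained by naturally adding $\alpha\to\beta$ to $\tilde F$. *)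

theory Defs
  imports Main
begin

definition abstract_simplicial_complex :: "'a set set \<Rightarrow> bool" where
  "abstract_simplicial_complex K \<longleftrightarrow>
     (\<forall>s\<in>K. finite s \<and> s \<noteq> {}) \<and>
     (\<forall>s\<in>K. \<forall>t. t \<subseteq> s \<and> t \<noteq> {} \<longrightarrow> t \<in> K)"

definition simplices :: "'a set set \<Rightarrow> nat \<Rightarrow> 'a set set" where
  "simplices K p = {s \<in> K. card s = Suc p}"

text \<open>A pair \<open>(a, b)\<close> is the arrow from \<open>a\<close> to \<open>b\<close>.\<close>

definition discrete_vector_field ::
    "'a set set \<Rightarrow> ('a set \<times> 'a set) set \<Rightarrow> bool" where
  "discrete_vector_field K F \<longleftrightarrow>
     (\<forall>(a, b)\<in>F. \<exists>p. a \<in> simplices K p \<and> b \<in> simplices K (Suc p) \<and> a \<subset> b) \<and>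
     (\<forall>(a, b)\<in>F. \<forall>(a', b')\<in>F. (a, b) \<noteq> (a', b') \<longrightarrow> {a, b} \<inter> {a', b'} = {})"

text \<open>Paths starting at a \<open>p\<close>-simplex. The sequence
  \<open>\<alpha>\<^sub>0, \<beta>\<^sub>0, \<alpha>\<^sub>1, \<dots>, \<beta>\<^sub>r, \<alpha>\<^bsub>r+1\<^esub>\<close> is stored as
  \<open>as = [\<alpha>\<^sub>0, \<dots>, \<alpha>\<^bsub>r+1\<^esub>]\<close> and \<open>bs = [\<beta>\<^sub>0, \<dots>, \<beta>\<^sub>r]\<close>; the trivial path has \<open>bs = []\<close>.\<close>

definition lower_path ::
    "'a set set \<Rightarrow> ('a set \<times> 'a set) set \<Rightarrow> nat \<Rightarrow> 'a set list \<Rightarrow> 'a set list \<Rightarrow> bool" where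
  "lower_path K F p as bs \<longleftrightarrow>
     length as = Suc (length bs) \<and>
     set as \<subseteq> simplices K p \<and> set bs \<subseteq> simplices K (Suc p) \<and>
     (\<forall>i<length bs. (as ! i, bs ! i) \<in> F \<and> as ! Suc i \<subset> bs ! i \<and> as ! i \<noteq> as ! Suc i)"

definition acyclic_field :: "'a set set \<Rightarrow> ('a set \<times> 'a set) set \<Rightarrow> bool" where
  "acyclic_field K F \<longleftrightarrow>
     discrete_vector_field K F \<and>
     \<not> (\<exists>p as bs. lower_path K F p as bs \<and> bs \<noteq> [] \<and> hd as = last as)"

text \<open>Paths starting at a \<open>(p+1)\<close>-simplex. The sequence
  \<open>\<beta>\<^sub>0 > \<alpha>\<^sub>1 \<rightarrow> \<beta>\<^sub>1 > \<dots> \<rightarrow> \<beta>\<^sub>r > \<alpha>\<^bsub>r+1\<^esub>\<close> is stored as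
  \<open>bs = [\<beta>\<^sub>0, \<dots>, \<beta>\<^sub>r]\<close> and \<open>as = [\<alpha>\<^sub>1, \<dots>, \<alpha>\<^bsub>r+1\<^esub>]\<close>; note the index shift
  \<open>as ! i = \<alpha>\<^bsub>i+1\<^esub>\<close>.\<close>

definition upper_path ::
    "'a set set \<Rightarrow> ('a set \<times> 'a set) set \<Rightarrow> nat \<Rightarrow> 'a set list \<Rightarrow> 'a set list \<Rightarrow> bool" where
  "upper_path K F p bs as \<longleftrightarrow>
     bs \<noteq> [] \<and> length as = length bs \<and>
     set bs \<subseteq> simplices K (Suc p) \<and> set as \<subseteq> simplices K p \<and>
     (\<forall>i<length bs. as ! i \<subset> bs ! i) \<and>
     (\<forall>i. Suc i < length bs \<longrightarrow>
        (as ! i, bs ! Suc i) \<in> F \<and> as ! i \<noteq> as ! Suc i \<and> bs ! i \<noteq> bs ! Suc i)"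

definition num_paths ::
    "'a set set \<Rightarrow> ('a set \<times> 'a set) set \<Rightarrow> nat \<Rightarrow> 'a set \<Rightarrow> 'a set \<Rightarrow> nat" where
  "num_paths K F p \<tau> \<sigma> =
     card {(bs, as). upper_path K F p bs as \<and> hd bs = \<tau> \<and> last as = \<sigma>}"

definition natural_addition ::
    "'a set set \<Rightarrow> ('a set \<times> 'a set) set \<Rightarrow> 'a set \<Rightarrow> 'a set \<Rightarrow> bool" where
  "natural_addition K G a b \<longleftrightarrow>
     acyclic_field K G \<and> (a, b) \<notin> G \<and> acyclic_field K (insert (a, b) G)"

text \<open>Deleting the arrow \<open>(a, b)\<close> changes \<open>F\<close> to \<open>F'\<close> naturally.\<close>

definition natural_deletion ::
    "'a set set \<Rightarrow> ('a set \<times> 'a set) set \<Rightarrow> 'a set \<Rightarrow> 'a set \<Rightarrow> ('a set \<times> 'a set) set \<Rightarrow> bool" where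
  "natural_deletion K F a b F' \<longleftrightarrow>
     natural_addition K F' a b \<and> F = insert (a, b) F'"

end

theory Submission
  imports Defs
begin

text \<open>An \<open>F\<close>-path that uses the arrow \<open>\<alpha> \<rightarrow> \<beta>\<close> splits there into a path ending at \<open>\<alpha>\<close> and a path
  starting at \<open>\<beta>\<close>. By acyclicity the arrow is used at most once, so the splitting is unique, and
  neither part uses the arrow again. Conversely, if \<open>\<tau> \<noteq> \<beta>\<close> and \<open>\<sigma> \<noteq> \<alpha>\<close>, then any path from \<open>\<tau>\<close> to
  \<open>\<alpha>\<close> can be joined with any path from \<open>\<beta>\<close> to \<open>\<sigma>\<close>: a path ending in \<open>\<beta> > \<alpha>\<close> must be just
  \<open>\<beta> > \<alpha>\<close>, as only \<open>\<alpha>\<close> has an arrow into \<open>\<beta>\<close>, and so must a path beginning with \<open>\<beta> > \<alpha>\<close>.\<close>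

section \<open>Joining and cutting paths\<close>

text \<open>Every condition on consecutive entries lies inside one of the two halves, except those
  at the junction index \<open>length bs1 - 1\<close>, which are listed separately. Read from left
  to right this cuts a path; from right to left it joins two.\<close>

lemma upper_path_append:
  assumes "length as1 = length bs1" and "length as2 = length bs2" and "bs1 \<noteq> []" and "bs2 \<noteq> []"
  shows "upper_path K F p (bs1 @ bs2) (as1 @ as2) \<longleftrightarrow>
    upper_path K F p bs1 as1 \<and> upper_path K F p bs2 as2 \<and>
    (last as1, hd bs2) \<in> F \<and> last as1 \<noteq> hd as2 \<and> last bs1 \<noteq> hd bs2"
    (is "?L \<longleftrightarrow> ?R")
proof
  let ?n = "length bs1"
  have ne: "as1 \<noteq> []" "as2 \<noteq> []"
    using assms by auto
  have last: "last as1 = as1 ! (?n - 1)" "last bs1 = bs1 ! (?n - 1)"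
    using assms ne by (simp_all add: last_conv_nth)
  have hd: "hd as2 = as2 ! 0" "hd bs2 = bs2 ! 0"
    using assms ne by (simp_all add: hd_conv_nth)
  {
    assume L: ?L
    have sub: "(as1 @ as2) ! i \<subset> (bs1 @ bs2) ! i" if "i < length (bs1 @ bs2)" for i
      using L that unfolding upper_path_def by blast
    have step: "((as1 @ as2) ! i, (bs1 @ bs2) ! Suc i) \<in> F \<and>
        (as1 @ as2) ! i \<noteq> (as1 @ as2) ! Suc i \<and> (bs1 @ bs2) ! i \<noteq> (bs1 @ bs2) ! Suc i"
      if "Suc i < length (bs1 @ bs2)" for i
      using L that unfolding upper_path_def by blast
    have sets: "set (bs1 @ bs2) \<subseteq> simplices K (Suc p)" "set (as1 @ as2) \<subseteq> simplices K p"
      using L unfolding upper_path_def by blast+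
    have "as1 ! i \<subset> bs1 ! i" if "i < ?n" for i
      using sub[of i] that assms by (simp add: nth_append)
    moreover have "(as1 ! i, bs1 ! Suc i) \<in> F \<and> as1 ! i \<noteq> as1 ! Suc i \<and> bs1 ! i \<noteq> bs1 ! Suc i"
      if "Suc i < ?n" for i
      using step[of i] that assms by (simp add: nth_append)
    ultimately have 1: "upper_path K F p bs1 as1"
      using sets assms unfolding upper_path_def by auto
    have "as2 ! i \<subset> bs2 ! i" if "i < length bs2" for i
      using sub[of "?n + i"] that assms by (simp add: nth_append)
    moreover have "(as2 ! i, bs2 ! Suc i) \<in> F \<and> as2 ! i \<noteq> as2 ! Suc i \<and> bs2 ! i \<noteq> bs2 ! Suc i"
      if "Suc i < length bs2" for i
      using step[of "?n + i"] that assms by (simp add: nth_append)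
    ultimately have 2: "upper_path K F p bs2 as2"
      using sets assms unfolding upper_path_def by auto
    \<comment> \<open>Index \<open>?n - 1\<close> is the junction: since \<open>bs1\<close> is
      nonempty, its successor \<open>?n\<close> is the first position of the second half.\<close>
    have "(last as1, hd bs2) \<in> F \<and> last as1 \<noteq> hd as2 \<and> last bs1 \<noteq> hd bs2"
      using step[of "?n - 1"] assms unfolding last hd by (auto simp: nth_append)
    with 1 2 show ?R
      by blast
  }
  {
    assume R: ?R
    have "((as1 @ as2) ! i, (bs1 @ bs2) ! Suc i) \<in> F \<and>
        (as1 @ as2) ! i \<noteq> (as1 @ as2) ! Suc i \<and> (bs1 @ bs2) ! i \<noteq> (bs1 @ bs2) ! Suc i"
      if i: "Suc i < length (bs1 @ bs2)" for i
    proof -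
      consider "Suc i < ?n" | "Suc i = ?n" | k where "i = ?n + k"
        by (metis Suc_lessI less_iff_Suc_add linorder_neqE_nat not_less_eq add_Suc_right)
      then show ?thesis
      proof cases
        case 1
        then show ?thesis
          using R assms by (simp add: nth_append upper_path_def)
      next
        case 2
        then have "i = ?n - 1"
          by simp
        then show ?thesis
          using R 2 assms unfolding last hd by (auto simp: nth_append)
      next
        case 3
        then show ?thesis
          using R i assms by (simp add: nth_append upper_path_def)
      qed
    qed
    moreover have "(as1 @ as2) ! i \<subset> (bs1 @ bs2) ! i" if "i < length (bs1 @ bs2)" for i
      using R that assms by (auto simp: nth_append upper_path_def)
    ultimately show ?L
      using R unfolding upper_path_def by auto
  }
qed

lemma upper_path_length: "upper_path K F p bs as \<Longrightarrow> length as = length bs"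
  by (simp add: upper_path_def)

lemma upper_path_not_Nil: "upper_path K F p bs as \<Longrightarrow> bs \<noteq> [] \<and> as \<noteq> []"
  by (auto simp: upper_path_def)

lemma upper_path_mono: "upper_path K F p bs as \<Longrightarrow> F \<subseteq> G \<Longrightarrow> upper_path K G p bs as"
  by (auto simp: upper_path_def)

text \<open>\<open>F\<close> enters \<open>upper_path\<close> only through the arrows at consecutive
  positions, so a path lost by removing \<open>(a, b)\<close> must contain that arrow, and it can be
  cut there.\<close>

lemma upper_path_split_arrow:
  assumes "upper_path K F p bs as" and "\<not> upper_path K (F - {(a, b)}) p bs as"
  obtains bs1 as1 bs2 as2 where "bs = bs1 @ bs2" and "as = as1 @ as2"
    and "upper_path K F p bs1 as1" and "upper_path K F p bs2 as2"
    and "last as1 = a" and "hd bs2 = b" and "a \<noteq> hd as2" and "last bs1 \<noteq> b"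
proof -
  obtain i where i: "Suc i < length bs" "as ! i = a" "bs ! Suc i = b"
    using assms by (auto simp: upper_path_def)
  have len: "length as = length bs"
    using assms(1) by (rule upper_path_length)
  \<comment> \<open>By the index shift the arrow leads from \<open>as ! i\<close> to
    \<open>bs ! Suc i\<close>; keeping \<open>Suc i\<close> entries of both lists leaves
    \<open>a\<close> last in the first half and \<open>b\<close> first in the second.\<close>
  let ?n = "Suc i"
  have "upper_path K F p (take ?n bs @ drop ?n bs) (take ?n as @ drop ?n as)"
    using assms(1) by simp
  then have "upper_path K F p (take ?n bs) (take ?n as) \<and> upper_path K F p (drop ?n bs) (drop ?n as) \<and>
      last (take ?n as) \<noteq> hd (drop ?n as) \<and> last (take ?n bs) \<noteq> hd (drop ?n bs)"
    using i len by (subst (asm) upper_path_append) auto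
  moreover have "last (take ?n as) = a" "hd (drop ?n bs) = b"
    using i len by (simp_all add: take_Suc_conv_app_nth hd_drop_conv_nth)
  ultimately show thesis
    using that[of "take ?n bs" "drop ?n bs" "take ?n as" "drop ?n as"] by simp
qed

section \<open>Consequences of acyclicity and of the uniqueness of arrows\<close>

text \<open>Putting \<open>last as\<close> in front of \<open>as\<close> would give a nontrivial
  closed lower path. The only condition that can fail is that its first two entries differ, and this
  failure is the conclusion.\<close>

lemma acyclic_field_no_closed_upper_path:
  assumes "acyclic_field K F" and "upper_path K F p bs as" and "(last as, hd bs) \<in> F"
  shows "hd as = last as"
proof (rule ccontr)
  assume ne: "hd as \<noteq> last as"
  have "bs \<noteq> []" "as \<noteq> []" "length as = length bs"
    using assms(2) by (auto simp: upper_path_def)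
  moreover have "lower_path K F p (last as # as) bs"
    unfolding lower_path_def
  proof (intro conjI allI impI)
    show "set (last as # as) \<subseteq> simplices K p"
      using assms(2) \<open>as \<noteq> []\<close> by (auto simp: upper_path_def)
    fix i
    assume "i < length bs"
    then show "((last as # as) ! i, bs ! i) \<in> F" "(last as # as) ! Suc i \<subset> bs ! i"
        "(last as # as) ! i \<noteq> (last as # as) ! Suc i"
      using assms ne \<open>as \<noteq> []\<close> \<open>bs \<noteq> []\<close>
      by (auto simp: upper_path_def nth_Cons hd_conv_nth split: nat.split)
  qed (use assms(2) in \<open>auto simp: upper_path_def\<close>)
  ultimately show False
    using assms(1) unfolding acyclic_field_def by force
qed

text \<open>Between two occurrences of a lower simplex \<open>y\<close> lies a path from the target
  of its arrow back to \<open>y\<close>. Acyclicity then forces the first lower simplex of that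
  segment to be \<open>y\<close>, whereas consecutive lower simplices differ.\<close>

lemma upper_path_distinct:
  assumes "acyclic_field K F" and path: "upper_path K F p bs as"
  shows "distinct as"
proof (rule ccontr)
  assume "\<not> distinct as"
  then obtain xs ys zs y where as: "as = (xs @ [y]) @ (ys @ [y]) @ zs"
    using not_distinct_decomp[of as] by auto
  define bs1 where "bs1 = take (Suc (length xs)) bs"
  define bs2 where "bs2 = take (Suc (length ys)) (drop (Suc (length xs)) bs)"
  define bs3 where "bs3 = drop (Suc (length ys)) (drop (Suc (length xs)) bs)"
  have bs: "bs = bs1 @ bs2 @ bs3"
    by (simp only: bs1_def bs2_def bs3_def append_take_drop_id)
  have len: "length (xs @ [y]) = length bs1" "length (ys @ [y]) = length bs2" "length zs = length bs3"
    using upper_path_length[OF path] by (simp_all add: as bs1_def bs2_def bs3_def)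
  then have ne: "bs1 \<noteq> []" "bs2 \<noteq> []"
    by auto
  have "upper_path K F p (bs2 @ bs3) ((ys @ [y]) @ zs) \<and>
      (last (xs @ [y]), hd (bs2 @ bs3)) \<in> F \<and> last (xs @ [y]) \<noteq> hd ((ys @ [y]) @ zs)"
    using path len ne upper_path_append[of "xs @ [y]" bs1 "(ys @ [y]) @ zs" "bs2 @ bs3" K F p]
    unfolding as bs by auto
  then have tail: "upper_path K F p (bs2 @ bs3) ((ys @ [y]) @ zs)"
    and arrow: "(y, hd bs2) \<in> F" and hd: "y \<noteq> hd (ys @ [y])"
    using ne by (auto simp: hd_append)
  have "upper_path K F p bs2 (ys @ [y])"
  \<comment> \<open>\<open>upper_path_append\<close> cuts only into nonempty halves, so a second
    occurrence of \<open>y\<close> at the very end is treated apart.\<close>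
  proof (cases "bs3 = []")
    case True
    then show ?thesis
      using tail len by simp
  next
    case False
    then show ?thesis
      using tail len ne upper_path_append[of "ys @ [y]" bs2 zs bs3] by auto
  qed
  from acyclic_field_no_closed_upper_path[OF assms(1) this] arrow hd show False
    by simp
qed

text \<open>Distinct lower simplices bound the length of both lists by \<open>card K\<close>.
  Finiteness is what makes the cardinality in \<open>num_paths\<close> a genuine count.\<close>

lemma finite_upper_paths:
  assumes "acyclic_field K F" and "finite K"
  shows "finite {(bs, as). upper_path K F p bs as \<and> P bs as}"
proof (rule finite_subset)
  let ?L = "{xs. set xs \<subseteq> K \<and> length xs \<le> card K}"
  show "finite (?L \<times> ?L)"
    using finite_lists_length_le[OF assms(2)] by blast
  show "{(bs, as). upper_path K F p bs as \<and> P bs as} \<subseteq> ?L \<times> ?L"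
  proof clarsimp
    fix bs as
    assume path: "upper_path K F p bs as"
    then have "set bs \<subseteq> K" "set as \<subseteq> K" "length as = length bs"
      by (auto simp: upper_path_def simplices_def)
    moreover have "length as \<le> card K"
      using upper_path_distinct[OF assms(1) path] \<open>set as \<subseteq> K\<close> assms(2)
      by (metis card_mono distinct_card)
    ultimately show "set bs \<subseteq> K \<and> length bs \<le> card K \<and> set as \<subseteq> K \<and> length as \<le> card K"
      by simp
  qed
qed

lemma acyclic_field_arrow_unique:
  assumes "acyclic_field K F" and "(a, b) \<in> F" and "(a', b') \<in> F" and "a = a' \<or> b = b'"
  shows "a = a' \<and> b = b'"
proof (rule ccontr)
  assume "\<not> (a = a' \<and> b = b')"
  have disjoint: "\<forall>(a, b)\<in>F. \<forall>(a', b')\<in>F. (a, b) \<noteq> (a', b') \<longrightarrow> {a, b} \<inter> {a', b'} = {}"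
    using assms(1)[unfolded acyclic_field_def discrete_vector_field_def]
    by (elim conjE)
  have "(a, b) \<noteq> (a', b') \<longrightarrow> {a, b} \<inter> {a', b'} = {}"
    using bspec[OF bspec[OF disjoint assms(2), unfolded prod.case] assms(3)]
    by (simp only: prod.case)
  then have "{a, b} \<inter> {a', b'} = {}"
    using \<open>\<not> (a = a' \<and> b = b')\<close> by simp
  then show False
    using assms(4) by blast
qed

text \<open>A second step would need an arrow from \<open>hd as\<close> to an upper simplex other
  than \<open>hd bs\<close>, but a source has only one target.\<close>

lemma upper_path_hd_arrow:
  assumes "acyclic_field K F" and "upper_path K F p bs as" and "(hd as, hd bs) \<in> F"
  shows "length bs = 1"
proof (rule ccontr)
  assume "length bs \<noteq> 1"
  moreover have ne: "bs \<noteq> []" "as \<noteq> []"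
    using assms(2) upper_path_not_Nil by blast+
  ultimately have "Suc 0 < length bs"
    by (cases bs) auto
  then have "(hd as, bs ! Suc 0) \<in> F" "hd bs \<noteq> bs ! Suc 0"
    using assms(2) ne by (auto simp: upper_path_def hd_conv_nth)
  then show False
    using acyclic_field_arrow_unique[OF assms(1,3)] by blast
qed

text \<open>Dually, a longer path would enter \<open>last bs\<close> by an arrow from a simplex
  other than \<open>last as\<close>, but a target has only one source.\<close>

lemma upper_path_last_arrow:
  assumes "acyclic_field K F" and "upper_path K F p bs as" and "(last as, last bs) \<in> F"
  shows "length bs = 1"
proof (rule ccontr)
  assume "length bs \<noteq> 1"
  have ne: "bs \<noteq> []" "as \<noteq> []" "length as = length bs"
    using assms(2) by (simp_all add: upper_path_def) (metis length_0_conv)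
  \<comment> \<open>The rule \<open>remdups_adj.cases\<close> distinguishes lists with no, one, or
    at least two entries.\<close>
  obtain i where i: "length bs = Suc (Suc i)"
    using ne(1) \<open>length bs \<noteq> 1\<close> by (cases bs rule: remdups_adj.cases) auto
  then have "last as = as ! Suc i" "last bs = bs ! Suc i"
    using ne by (simp_all add: last_conv_nth)
  then have "(as ! i, last bs) \<in> F" "as ! i \<noteq> last as"
    using assms(2) i by (auto simp: upper_path_def)
  then show False
    using acyclic_field_arrow_unique[OF assms(1,3)] by blast
qed

section \<open>The effect of deleting an arrow\<close>

text \<open>If a path using the arrow ends at \<open>a\<close>, its second half runs from
  \<open>b\<close> to \<open>a\<close>, so acyclicity gives \<open>hd as2 = a\<close>. If it starts
  at \<open>b\<close>, its first half does so, and collapses to the single face relation from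
  \<open>b\<close> to \<open>a\<close>, so \<open>last bs1 = b\<close>. The junction conditions
  exclude both.\<close>

lemma upper_path_delete_arrow:
  assumes "acyclic_field K F" and "(a, b) \<in> F" and "upper_path K F p bs as"
    and "last as = a \<or> hd bs = b"
  shows "upper_path K (F - {(a, b)}) p bs as"
proof (rule ccontr)
  assume "\<not> ?thesis"
  then obtain bs1 as1 bs2 as2 where split: "bs = bs1 @ bs2" "as = as1 @ as2"
    and paths: "upper_path K F p bs1 as1" "upper_path K F p bs2 as2"
    and ends: "last as1 = a" "hd bs2 = b" "a \<noteq> hd as2" "last bs1 \<noteq> b"
    by (rule upper_path_split_arrow[OF assms(3)])
  have ne: "bs1 \<noteq> []" "as2 \<noteq> []"
    using upper_path_not_Nil[OF paths(1)] upper_path_not_Nil[OF paths(2)] by simp_all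
  show False
  proof (cases "last as = a")
    case True
    then have "last as2 = a"
      using split ne by simp
    then show False
      using acyclic_field_no_closed_upper_path[OF assms(1) paths(2)] ends assms(2) by simp
  next
    case False
    then have "hd bs1 = b"
      using assms(4) split ne by simp
    then have "(hd as1, hd bs1) \<in> F"
      using acyclic_field_no_closed_upper_path[OF assms(1) paths(1)] ends assms(2) by simp
    then have "length bs1 = 1"
      by (rule upper_path_hd_arrow[OF assms(1) paths(1)])
    then show False
      using \<open>hd bs1 = b\<close> ends(4) by (cases bs1) simp_all
  qed
qed

text \<open>The additive form avoids truncated subtraction on naturals; the difference is taken over
  the integers only at the end.\<close>

lemma num_paths_delete_arrow:
  assumes acyc: "acyclic_field K F" and "finite K" and arrow: "(a, b) \<in> F"
    and "t \<noteq> b" and "s \<noteq> a"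
  shows "num_paths K F p t s =
    num_paths K (F - {(a, b)}) p t s + num_paths K F p t a * num_paths K F p b s"
proof -
  let ?G = "F - {(a, b)}"
  \<comment> \<open>The field is a parameter of \<open>P\<close>, so that one notation serves both
    \<open>F\<close> and \<open>?G\<close>.\<close>
  define P where "P F t s = {(bs, as). upper_path K F p bs as \<and> hd bs = t \<and> last as = s}" for F t s
  define join where
    "join = (\<lambda>((bs1, as1), (bs2, as2)). (bs1 @ bs2, as1 @ as2) :: 'a set list \<times> 'a set list)"
  have join_path: "upper_path K F p (bs1 @ bs2) (as1 @ as2)"
    if "(bs1, as1) \<in> P F t a" "(bs2, as2) \<in> P F b s" for bs1 as1 bs2 as2
  proof -
    have paths: "upper_path K F p bs1 as1" "upper_path K F p bs2 as2"
      and ends: "hd bs1 = t" "last as1 = a" "hd bs2 = b" "last as2 = s"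
      using that by (auto simp: P_def)
    have "last bs1 \<noteq> b"
    proof
      assume "last bs1 = b"
      moreover from this have "length bs1 = 1"
        using upper_path_last_arrow[OF acyc paths(1)] arrow ends by simp
      ultimately show False
        using ends(1) \<open>t \<noteq> b\<close> by (cases bs1) simp_all
    qed
    moreover have "hd as2 \<noteq> a"
    proof
      assume "hd as2 = a"
      moreover from this have "length as2 = 1"
        using upper_path_hd_arrow[OF acyc paths(2)] upper_path_length[OF paths(2)] arrow ends by simp
      ultimately show False
        using ends(4) \<open>s \<noteq> a\<close> by (cases as2) simp_all
    qed
    ultimately show ?thesis
      using paths ends arrow
      by (subst upper_path_append) (auto simp: upper_path_length upper_path_not_Nil)
  qed
  have inj: "inj_on join (P F t a \<times> P F b s)"
  proof (rule inj_onI)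
    fix x x'
    assume "x \<in> P F t a \<times> P F b s" "x' \<in> P F t a \<times> P F b s" and join_eq: "join x = join x'"
    then obtain bs1 as1 bs2 as2 bs1' as1' bs2' as2'
      where x: "x = ((bs1, as1), (bs2, as2))" "x' = ((bs1', as1'), (bs2', as2'))"
        and mem: "(bs1, as1) \<in> P F t a" "(bs2, as2) \<in> P F b s"
          "(bs1', as1') \<in> P F t a" "(bs2', as2') \<in> P F b s"
      by (metis SigmaE surj_pair)
    from join_eq x have eq: "bs1 @ bs2 = bs1' @ bs2'" "as1 @ as2 = as1' @ as2'"
      by (auto simp: join_def)
    have len: "length as1 = length bs1" "length as1' = length bs1'"
      and ne: "as1 \<noteq> []" "as1' \<noteq> []" and ends: "last as1 = a" "last as1' = a"
      using mem by (auto simp: P_def upper_path_def)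
    \<comment> \<open>Both cuts come right after an occurrence of \<open>a\<close> in the same list;
      distinctness makes the two positions equal.\<close>
    have "distinct (as1 @ as2)"
      using upper_path_distinct[OF acyc join_path] mem by blast
    moreover have "(as1 @ as2) ! (length as1 - 1) = a"
      using ne ends by (simp add: nth_append last_conv_nth)
    moreover have "(as1 @ as2) ! (length as1' - 1) = a"
      unfolding eq(2) using ne ends by (simp add: nth_append last_conv_nth)
    moreover have "length as1 - 1 < length (as1 @ as2)"
      using ne by (cases as1) auto
    moreover have "length as1' - 1 < length (as1 @ as2)"
      unfolding eq(2) using ne by (cases as1') auto
    ultimately have "length as1 - 1 = length as1' - 1"
      using nth_eq_iff_index_eq by blast
    then have "length as1 = length as1'"
      using ne by (cases as1; cases as1') auto
    then show "x = x'"
      using eq len by (simp add: x)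
  qed
  have image: "join ` (P F t a \<times> P F b s) = P F t s - P ?G t s"
  proof (intro equalityI subsetI)
    fix x
    assume "x \<in> join ` (P F t a \<times> P F b s)"
    then obtain bs1 as1 bs2 as2 where x: "x = (bs1 @ bs2, as1 @ as2)"
      and mem: "(bs1, as1) \<in> P F t a" "(bs2, as2) \<in> P F b s"
      by (auto simp: join_def)
    then have props: "length as1 = length bs1" "length as2 = length bs2" "bs1 \<noteq> []" "bs2 \<noteq> []"
        "as2 \<noteq> []" "hd bs1 = t" "last as1 = a" "hd bs2 = b" "last as2 = s"
      by (auto simp: P_def upper_path_def)
    \<comment> \<open>The junction of a joined path is the arrow \<open>(a, b)\<close> itself, which
      is missing from \<open>?G\<close>.\<close>
    then have "\<not> upper_path K ?G p (bs1 @ bs2) (as1 @ as2)"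
      by (simp add: upper_path_append)
    then show "x \<in> P F t s - P ?G t s"
      using join_path[OF mem] props by (simp add: P_def x)
  next
    fix x
    assume "x \<in> P F t s - P ?G t s"
    then obtain bs as where x: "x = (bs, as)" and path: "upper_path K F p bs as"
      and ends: "hd bs = t" "last as = s" and "\<not> upper_path K ?G p bs as"
      by (auto simp: P_def)
    then obtain bs1 as1 bs2 as2 where split: "bs = bs1 @ bs2" "as = as1 @ as2"
      and paths: "upper_path K F p bs1 as1" "upper_path K F p bs2 as2"
      and "last as1 = a" "hd bs2 = b"
      using upper_path_split_arrow by metis
    then have "(bs1, as1) \<in> P F t a" "(bs2, as2) \<in> P F b s"
      using ends upper_path_not_Nil[OF paths(1)] upper_path_not_Nil[OF paths(2)]
      by (auto simp: P_def)
    then show "x \<in> join ` (P F t a \<times> P F b s)"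
      unfolding x split by (force simp: join_def)
  qed
  have fin: "finite (P F t s)"
    unfolding P_def by (rule finite_upper_paths[OF acyc \<open>finite K\<close>])
  have sub: "P ?G t s \<subseteq> P F t s"
    by (auto simp: P_def intro: upper_path_mono)
  have "card (P F t a) * card (P F b s) = card (P F t s - P ?G t s)"
    using card_image[OF inj] by (simp add: image card_cartesian_product)
  also have "\<dots> = card (P F t s) - card (P ?G t s)"
    using sub fin by (meson card_Diff_subset finite_subset)
  finally show ?thesis
    \<comment> \<open>Monotonicity ensures that the natural-number difference is not truncated, so
      it can be turned into a sum.\<close>
    using card_mono[OF fin sub] by (simp add: num_paths_def P_def)
qed

theorem lemma4p9:
  fixes K :: "'a set set" and F F' :: "('a set \<times> 'a set) set"
    and \<alpha> \<beta> :: "'a set" and p :: nat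
  assumes "abstract_simplicial_complex K" and "finite K"
    and "acyclic_field K F"
    and "\<alpha> \<in> simplices K p" and "\<beta> \<in> simplices K (Suc p)"
    and "(\<alpha>, \<beta>) \<in> F"
    and "F' = F - {(\<alpha>, \<beta>)}"
    and "natural_deletion K F \<alpha> \<beta> F'"
  shows "(\<forall>bs as. upper_path K F p bs as \<and> (last as = \<alpha> \<or> hd bs = \<beta>)
            \<longrightarrow> upper_path K F' p bs as) \<and>
         (\<forall>\<tau> \<in> simplices K (Suc p). \<forall>\<sigma> \<in> simplices K p. \<tau> \<noteq> \<beta> \<and> \<sigma> \<noteq> \<alpha> \<longrightarrow>
            int (num_paths K F' p \<tau> \<sigma>) =
            int (num_paths K F p \<tau> \<sigma>) - int (num_paths K F p \<tau> \<alpha>) * int (num_paths K F p \<beta> \<sigma>))"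
proof (intro conjI allI impI ballI)
  fix bs as
  assume "upper_path K F p bs as \<and> (last as = \<alpha> \<or> hd bs = \<beta>)"
  then show "upper_path K F' p bs as"
    using upper_path_delete_arrow[OF assms(3,6)] assms(7) by blast
next
  fix \<tau> \<sigma>
  assume "\<tau> \<noteq> \<beta> \<and> \<sigma> \<noteq> \<alpha>"
  then show "int (num_paths K F' p \<tau> \<sigma>) =
      int (num_paths K F p \<tau> \<sigma>) - int (num_paths K F p \<tau> \<alpha>) * int (num_paths K F p \<beta> \<sigma>)"
    using num_paths_delete_arrow[OF assms(3,2,6)] assms(7) by simp
qed

end
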